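(* Let $A$ be the Hurt-Sada array, let $\varphi=(1+\sqrt5)/2$, and let $d(n)=A[n,n]$ be its diagonal sequence. There is an $8$-state finite automaton, taking the Zeckendorf representation of $n$ as input, that decides whether $d(n)\ge n$ or $d(n)<n$. Further, the diagonal sequence $d(n)=A[n,n]$ satisfies $$d(n)<n\implies d(n)=\lfloor (4-2\varphi)n+(5-3\varphi)\rfloor$$ and $$d(n)\ge n\implies d(n)=\lfloor (2\varphi-2)n\rfloor+1.$$
   Context: The Hurt-Sada array $A=(A[n,k])_{n,k\ge 0}$ is defined as follows. Row $0$ is $A[0,k]=k$ for all $k\ge 0$. For $n\ge 1$, row $n$ is obtained from row $n-1$ by finding the unique occurrence of $n$ in row $n-1$, say $A[n-1,i]=n$, and shifting this entry $n$ positions to the right (it jumps over the next $n$ entries): $A[n,j]=A[n-1,j]$ for $0\le j<i$; $A[n,j]=A[n-1,j+1]$ for $i\le j<i+n$; $A[n,i+n]=n$; and $A[n,j]=A[n-1,j]$ for $j>i+n$. Each row is a permutation of $\{0,1,2,\ldots\}$. Zeckendorf representation: with $F_0=0$, $F_1=1$, $F_i=F_{i-1}+F_{i-2}$ for $i\ge 2$, every non-negative integer is uniquely a sum of distinct Fibonacci numbers $F_i$, $i\ge 2$, no two of them adjacent. It is written as a binary string $a_1a_2\cdots a_t$, most significant digit first, representing $\sum_{1\le i\le t}a_iF_{t+2-i}$. A finite automaton has a finite set of states, labeled transitions between states, an initial state and a set of accepting states; it reads a finite input string starting in the initial state, following the transitions, and accepts if it is in an accepting state after reading the whole string; otherwise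 it rejects.
   Formalization: The second formula, for d(n) ≥ n, is stated only for n ≥ 1, because at n = 0 it fails: d(0) = 0 ≥ 0, while ⌊(2φ−2)·0⌋ + 1 = 1. *)

theory Defs
  imports Complex_Main "HOL-Number_Theory.Fib"
begin

(* Row r with the entry n moved n positions to the right; r is meant to be a permutation,
   so that the position i of n is unique. *)
definition jump_right :: "nat \<Rightarrow> (nat \<Rightarrow> nat) \<Rightarrow> nat \<Rightarrow> nat" where
  "jump_right n r j =
     (let i = (THE i. r i = n) in
        if j < i then r j
        else if j < i + n then r (j + 1)
        else if j = i + n then n
        else r j)"

primrec hurt_sada :: "nat \<Rightarrow> nat \<Rightarrow> nat" where
  "hurt_sada 0 = (\<lambda>k. k)"
| "hurt_sada (Suc m) = jump_right (Suc m) (hurt_sada m)"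

definition hs_diag :: "nat \<Rightarrow> nat" where
  "hs_diag n = hurt_sada n n"

definition golden_ratio :: real where
  "golden_ratio = (1 + sqrt 5) / 2"

lemma bij_jump_right:
  assumes "bij r"
  shows "bij (jump_right n r)"
proof -
  define i where "i = (THE i. r i = n)"
  have "\<exists>!i. r i = n"
    using assms by (metis bij_iff)
  then have ri: "r i = n"
    unfolding i_def by (rule theI')
  define s where
    "s = (\<lambda>j. if j < i then j else if j < i + n then j + 1 else if j = i + n then i else j)"
  define t where
    "t = (\<lambda>j. if j < i then j else if j = i then i + n else if j \<le> i + n then j - 1 else j)"
  have "bij s"
    by (rule o_bij[of t]) (auto simp: s_def t_def fun_eq_iff)
  moreover have "jump_right n r = r \<circ> s"
    by (auto simp: fun_eq_iff jump_right_def Let_def s_def ri simp flip: i_def)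
  ultimately show ?thesis
    using assms by (simp add: bij_comp)
qed

lemma bij_hurt_sada: "bij (hurt_sada n)"
  by (induction n) (auto simp: bij_jump_right bij_id[unfolded id_def])

(* Digit strings are most significant digit first, with True as the digit 1.  The list index j
   starts at 0, so the summand for j is the one of the digit number i = j + 1, whose weight is
   fib (length w + 2 - i). *)
definition fib_value :: "bool list \<Rightarrow> nat" where
  "fib_value w = (\<Sum>j<length w. of_bool (w ! j) * fib (length w + 1 - j))"

(* Leading zeros are allowed; in particular both [] and [False] represent 0. *)
definition zeckendorf_rep :: "bool list \<Rightarrow> nat \<Rightarrow> bool" where
  "zeckendorf_rep w n \<longleftrightarrow>
     (\<forall>j. j + 1 < length w \<longrightarrow> \<not> (w ! j \<and> w ! (j + 1))) \<and> fib_value w = n"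

record ('q, 'a) automaton =
  states :: "'q set"
  trans_fun :: "'q \<Rightarrow> 'a \<Rightarrow> 'q"
  start :: 'q
  accepting :: "'q set"

definition finite_automaton :: "('q, 'a) automaton \<Rightarrow> bool" where
  "finite_automaton M \<longleftrightarrow>
     finite (states M) \<and> start M \<in> states M \<and> accepting M \<subseteq> states M \<and>
     (\<forall>q\<in>states M. \<forall>a. trans_fun M q a \<in> states M)"

definition accepts :: "('q, 'a) automaton \<Rightarrow> 'a list \<Rightarrow> bool" where
  "accepts M w \<longleftrightarrow> foldl (trans_fun M) (start M) w \<in> accepting M"

end

theory Submission
  imports Defs
begin

text \<open>
  Put \<open>H(k) = \<lfloor>(k + 1)/\<phi>\<rfloor>\<close>. An entry \<open>v > n\<close> of row \<open>n\<close> moves one step left each time a smaller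
  entry jumps over it; an entry \<open>v \<le> n\<close> has jumped from \<open>H(v)\<close> to \<open>H(v) + v\<close> and then moves one step
  left per row until it settles at position \<open>v\<close>. This gives closed formulas for all positions, so
  \<open>d(n)\<close> is obtained by solving \<open>v + H(v) = 2n + 1\<close> (entries \<open>v > n\<close>) or \<open>2v + H(v) = 2n\<close> (entries
  \<open>v \<le> n\<close>). Exactly one of the two is solvable, depending on whether \<open>2n + 2\<close> is a lower or an upper
  Wythoff number, that is, on the fractional part of \<open>(2n + 2)/\<phi>\<close>. If \<open>n\<close> is the sum of the
  Fibonacci numbers \<open>F\<^sub>i\<close>, this fractional part is determined by the sum of the corresponding
  \<open>(1 - \<phi>)\<^sup>i\<close>, which the automaton tracks up to finitely many intervals.
\<close>

section \<open>The golden ratio\<close>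

lemma golden_ratio_sq: "golden_ratio * golden_ratio = golden_ratio + 1"
  by (simp add: golden_ratio_def field_simps)

text \<open>With \<open>golden_ratio_sq\<close> it lets simplification reduce polynomials in \<phi>
  to linear ones.\<close>

lemma golden_ratio_mult_left: "golden_ratio * (golden_ratio * x) = golden_ratio * x + x"
  by (metis golden_ratio_sq distrib_right mult.assoc mult_1)

lemma golden_ratio_bounds: "8 / 5 < golden_ratio" "golden_ratio < 13 / 8"
proof -
  have "11 / 5 < sqrt (5::real)"
    by (rule real_less_rsqrt) (simp add: power2_eq_square)
  moreover have "sqrt (5::real) < 9 / 4"
    by (rule real_less_lsqrt) (simp_all add: power2_eq_square)
  ultimately show "8 / 5 < golden_ratio" "golden_ratio < 13 / 8"
    by (simp_all add: golden_ratio_def)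
qed

text \<open>Infinite descent: parity forces both numbers to be even, and halving them gives a
  smaller solution.\<close>

lemma golden_equation_nat: "b * b = a * b + a * a \<Longrightarrow> a = 0" for a b :: nat
proof (induction a arbitrary: b rule: less_induct)
  case (less a)
  have "even (b * b) \<longleftrightarrow> even (a * b + a * a)"
    using less.prems by simp
  then have "even a" "even b"
    by auto
  then obtain c d where "a = 2 * c" "b = 2 * d"
    by (auto elim!: evenE)
  then show ?case
    using less.IH[of c d] less.prems by (cases "c = 0") auto
qed

lemma golden_ratio_irrational:
  assumes "of_nat a * golden_ratio = of_int b"
  shows "a = 0"
proof -
  have "0 \<le> of_nat a * golden_ratio"
    using golden_ratio_bounds by (intro mult_nonneg_nonneg) auto
  then have "b \<ge> 0"
    unfolding assms by simp
  then obtain c where c: "b = int c"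
    using nonneg_int_cases by blast
  then have eq: "real c = real a * golden_ratio"
    using assms by simp
  have "real c * real c = real a * real c + real a * real a"
    unfolding eq using golden_ratio_sq by (simp add: algebra_simps golden_ratio_mult_left)
  then have "c * c = a * c + a * a"
    by (metis of_nat_add of_nat_eq_iff of_nat_mult)
  then show ?thesis
    by (rule golden_equation_nat)
qed

section \<open>The rows of the array\<close>

text \<open>This is H, as \<open>golden_ratio - 1\<close> is 1/\<phi>. For \<open>k > 0\<close> it
  turns out to be the position of \<open>k\<close> in row \<open>k - 1\<close>.\<close>

definition golden_index :: "nat \<Rightarrow> nat" where
  "golden_index k = nat \<lfloor>real (k + 1) * (golden_ratio - 1)\<rfloor>"

lemma int_golden_index: "int (golden_index k) = \<lfloor>real (k + 1) * (golden_ratio - 1)\<rfloor>"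
  using golden_ratio_bounds by (simp add: golden_index_def)

lemma int_golden_index_add: "int (k + golden_index k) = \<lfloor>real (k + 1) * golden_ratio\<rfloor> - 1"
proof -
  have "real (k + 1) * golden_ratio = real (k + 1) * (golden_ratio - 1) + of_int (int k + 1)"
    by (simp add: algebra_simps)
  then show ?thesis
    by (simp only: floor_add_int[symmetric] int_golden_index[symmetric])
qed

lemma le_golden_index_iff: "k \<le> golden_index n \<longleftrightarrow> real k \<le> real (n + 1) * (golden_ratio - 1)"
proof -
  have "k \<le> golden_index n \<longleftrightarrow> int k \<le> int (golden_index n)"
    by simp
  then show ?thesis
    unfolding int_golden_index le_floor_iff by simp
qed

lemma golden_index_mono: "m \<le> n \<Longrightarrow> golden_index m \<le> golden_index n"
  unfolding golden_index_def
  using golden_ratio_bounds by (intro nat_mono floor_mono mult_right_mono) auto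

lemma golden_index_le: "golden_index k \<le> k"
proof -
  have "real (k + 1) * (golden_ratio - 1) < real (k + 1) * 1"
    using golden_ratio_bounds by (intro mult_strict_left_mono) auto
  then show ?thesis
    using le_golden_index_iff[of "Suc k" k] by simp
qed

lemma golden_index_eq_0_iff: "golden_index k = 0 \<longleftrightarrow> k = 0"
proof -
  have "1 \<le> real (k + 1) * (golden_ratio - 1)" if "k \<ge> 1"
  proof -
    have "2 * (golden_ratio - 1) \<le> real (k + 1) * (golden_ratio - 1)"
      using that golden_ratio_bounds by (intro mult_right_mono) auto
    then show ?thesis
      using golden_ratio_bounds by simp
  qed
  then show ?thesis
    using le_golden_index_iff[of 1 k] golden_index_le[of k] by fastforce
qed

text \<open>Multiplying by 1/\<phi> inverts the Beatty sequence of \<phi>; irrationality makes the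
  strict and the weak inequality agree.\<close>

lemma golden_index_galois: "k + golden_index k \<le> n \<longleftrightarrow> k < golden_index (Suc n)"
proof -
  have "k + golden_index k \<le> n \<longleftrightarrow> \<lfloor>real (k + 1) * golden_ratio\<rfloor> < int n + 2"
    using int_golden_index_add[of k] by linarith
  also have "\<dots> \<longleftrightarrow> real (k + 1) * golden_ratio < real (n + 2)"
    by (simp add: floor_less_iff ac_simps)
  also have "\<dots> \<longleftrightarrow> real (k + 1) * golden_ratio * (golden_ratio - 1) < real (n + 2) * (golden_ratio - 1)"
    using golden_ratio_bounds by (intro mult_less_cancel_right_pos[symmetric]) auto
  also have "real (k + 1) * golden_ratio * (golden_ratio - 1) = real (k + 1)"
    by (simp add: algebra_simps golden_ratio_sq golden_ratio_mult_left)
  also have "real (k + 1) < real (n + 2) * (golden_ratio - 1) \<longleftrightarrow>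
      real (k + 1) \<le> real (n + 2) * (golden_ratio - 1)"
  proof -
    have "real (k + 1) \<noteq> real (n + 2) * (golden_ratio - 1)"
      using golden_ratio_irrational[of "n + 2" "int (k + n + 3)"] by (auto simp: algebra_simps)
    then show ?thesis
      by auto
  qed
  also have "\<dots> \<longleftrightarrow> k < golden_index (Suc n)"
    using le_golden_index_iff[of "k + 1" "Suc n"] by (simp add: Suc_le_eq)
  finally show ?thesis .
qed

text \<open>For \<open>v \<le> n\<close>, the drift left from H(v) + v has lasted
  \<open>n - v\<close> rows; \<open>max\<close> stops it at \<open>v\<close> and absorbs truncated
  subtraction. An entry \<open>v > n\<close> rests at \<open>v\<close> in the rows before row H(v)
  and then drifts left.\<close>

definition hs_position :: "nat \<Rightarrow> nat \<Rightarrow> nat" where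
  "hs_position n v =
     (if v \<le> n then max v (golden_index v + 2 * v - n)
      else min v (v - n + golden_index v - 1))"

text \<open>Follows an entry from its old position \<open>p\<close> to its new position
  \<open>q\<close>, whereas \<open>jump_right\<close> looks up the entry at a position.\<close>

lemma jump_right_eqI:
  assumes "bij r" "r i = n" "r p = v"
    and "q = (if p < i then p else if p = i then i + n else if p \<le> i + n then p - 1 else p)"
  shows "jump_right n r q = v"
proof -
  have "(THE i. r i = n) = i"
    using assms(1,2) by (intro the_equality) (auto dest: bij_is_inj injD)
  then show ?thesis
    using assms by (auto simp: jump_right_def)
qed

lemma hs_position_Suc_self: "hs_position n (Suc n) = golden_index (Suc n)"
  using golden_index_le[of "Suc n"] by (simp add: hs_position_def)

text \<open>By \<open>golden_index_galois\<close>, an entry \<open>v \<le> n\<close> has settled iff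
  it lies left of the jump, and an entry \<open>v > Suc n\<close> still rests at \<open>v\<close> in
  row \<open>Suc n\<close> iff the jump ends left of \<open>v\<close>.\<close>

lemma hs_position_step:
  "hs_position (Suc n) v =
     (let p = hs_position n v; i = golden_index (Suc n)
      in if p < i then p else if p = i then i + Suc n else if p \<le> i + Suc n then p - 1 else p)"
proof -
  consider "v \<le> n" | "v = Suc n" | "v > Suc n"
    by linarith
  then show ?thesis
  proof cases
    case 1
    then show ?thesis
      using golden_index_galois[of v n] golden_index_mono[of v "Suc n"]
      by (auto simp: hs_position_def Let_def max_def)
  next
    case 2
    then show ?thesis
      using hs_position_Suc_self[of n] by (auto simp: Let_def hs_position_def)
  next
    case 3
    then show ?thesis
      using golden_index_galois[of "Suc n" "v - 1"] golden_index_mono[of "Suc n" v]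
        golden_index_eq_0_iff[of v]
      by (auto simp: hs_position_def Let_def min_def)
  qed
qed

lemma hurt_sada_hs_position: "hurt_sada n (hs_position n v) = v"
proof (induction n arbitrary: v)
  case 0
  then show ?case
    using golden_index_eq_0_iff[of v] by (auto simp: hs_position_def min_def)
next
  case (Suc n)
  have "hurt_sada n (golden_index (Suc n)) = Suc n"
    using Suc.IH[of "Suc n"] by (simp only: hs_position_Suc_self)
  then show ?case
    using Suc.IH[of v] hs_position_step[of n v]
    by (auto intro!: jump_right_eqI[OF bij_hurt_sada] simp: Let_def)
qed

section \<open>The diagonal\<close>

text \<open>Let v be the floor of x, the argument of \<open>frac\<close>. Then (v + 1)\<phi> exceeds
  2n + 2 by (1 - frac x)\<phi>, which is below 1 by the hypothesis, so v + H(v) = 2n + 1.\<close>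

lemma hs_diag_lower:
  assumes "frac (real (2 * n + 2) * (golden_ratio - 1)) > 2 - golden_ratio"
  shows "int (hs_diag n) = \<lfloor>real (2 * n + 2) * (golden_ratio - 1)\<rfloor>" and "hs_diag n > n"
proof -
  define x where "x = real (2 * n + 2) * (golden_ratio - 1)"
  define v where "v = nat \<lfloor>x\<rfloor>"
  have "x \<ge> 0"
    using golden_ratio_bounds by (simp add: x_def)
  then have v: "real v = x - frac x" "int v = \<lfloor>x\<rfloor>"
    by (simp_all add: v_def frac_def)
  have fr: "2 - golden_ratio < frac x" "frac x < 1"
    using assms by (simp_all add: x_def frac_lt_1)
  have "real (v + 1) * golden_ratio = real (2 * n + 2) + (1 - frac x) * golden_ratio"
    unfolding of_nat_add v x_def
    by (simp add: algebra_simps golden_ratio_sq golden_ratio_mult_left)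
  moreover have "(1 - frac x) * golden_ratio < (golden_ratio - 1) * golden_ratio"
    using fr golden_ratio_bounds by (intro mult_strict_right_mono) auto
  moreover have "0 \<le> (1 - frac x) * golden_ratio"
    using fr golden_ratio_bounds by (intro mult_nonneg_nonneg) auto
  moreover have "(golden_ratio - 1) * golden_ratio = 1"
    by (simp add: algebra_simps golden_ratio_sq)
  ultimately have "\<lfloor>real (v + 1) * golden_ratio\<rfloor> = int (2 * n + 2)"
    by (intro floor_unique) auto
  then have "v + golden_index v = 2 * n + 1"
    using int_golden_index_add[of v] by linarith
  moreover from this have "v > n"
    using golden_index_le[of v] by linarith
  ultimately have "hs_position n v = n"
    by (auto simp: hs_position_def min_def)
  then have "hs_diag n = v"
    using hurt_sada_hs_position[of n v] by (simp add: hs_diag_def)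
  then show "int (hs_diag n) = \<lfloor>real (2 * n + 2) * (golden_ratio - 1)\<rfloor>" "hs_diag n > n"
    using v \<open>v > n\<close> by (simp_all add: x_def)
qed

text \<open>Dual to \<open>hs_diag_lower\<close>, with \<open>golden_ratio + 1\<close>, the square
  of \<phi>, in place of \<phi>; its reciprocal is \<open>2 - golden_ratio\<close>.\<close>

lemma hs_diag_upper:
  assumes "frac (real (2 * n + 2) * (golden_ratio - 1)) \<le> 2 - golden_ratio"
  shows "int (hs_diag n) = 2 * int n + 1 - \<lfloor>real (2 * n + 2) * (golden_ratio - 1)\<rfloor>"
    and "n > 0 \<Longrightarrow> hs_diag n < n"
proof -
  define x where "x = real (2 * n + 2) * (golden_ratio - 1)"
  define v where "v = nat (2 * int n + 1 - \<lfloor>x\<rfloor>)"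
  have "x < real (2 * n + 2) * 1"
    unfolding x_def using golden_ratio_bounds by (intro mult_strict_left_mono) auto
  then have "\<lfloor>x\<rfloor> < 2 * int n + 2"
    by (simp add: floor_less_iff)
  then have v: "int v = 2 * int n + 1 - \<lfloor>x\<rfloor>"
    by (simp add: v_def)
  have rv: "real (v + 1) = real (2 * n + 2) - x + frac x"
  proof -
    have "real_of_int (int v) = real_of_int (2 * int n + 1 - \<lfloor>x\<rfloor>)"
      by (simp only: v)
    then show ?thesis
      by (simp add: frac_def)
  qed
  \<comment> \<open>Equality would make (2n + 3)\<phi> an integer.\<close>
  have "frac x \<noteq> 2 - golden_ratio"
  proof
    assume "frac x = 2 - golden_ratio"
    then have "of_nat (2 * n + 3) * golden_ratio = of_int (\<lfloor>x\<rfloor> + 2 * int n + 4)"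
      by (simp add: frac_def x_def algebra_simps)
    from golden_ratio_irrational[OF this] show False
      by simp
  qed
  then have fr: "frac x < 2 - golden_ratio"
    using assms by (simp add: x_def)
  have eq: "real (v + 1) * (golden_ratio + 1) = real (2 * n + 2) + frac x * (golden_ratio + 1)"
    unfolding rv x_def by (simp add: algebra_simps golden_ratio_sq golden_ratio_mult_left)
  have "frac x * (golden_ratio + 1) < (2 - golden_ratio) * (golden_ratio + 1)"
    using fr golden_ratio_bounds by (intro mult_strict_right_mono) auto
  moreover have "0 \<le> frac x * (golden_ratio + 1)"
    using golden_ratio_bounds by (intro mult_nonneg_nonneg) auto
  moreover have "(2 - golden_ratio) * (golden_ratio + 1) = 1"
    by (simp add: algebra_simps golden_ratio_sq)
  ultimately have "\<lfloor>real (v + 1) * (golden_ratio + 1)\<rfloor> = int (2 * n + 2)"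
    unfolding eq by (intro floor_unique) auto
  moreover have "real (v + 1) * (golden_ratio + 1) = real (v + 1) * golden_ratio + of_int (int v + 1)"
    by (simp add: algebra_simps)
  ultimately have "\<lfloor>real (v + 1) * golden_ratio\<rfloor> + (int v + 1) = int (2 * n + 2)"
    by (simp only: floor_add_int)
  then have vn: "2 * v + golden_index v = 2 * n"
    using int_golden_index_add[of v] by linarith
  then have "hs_position n v = n"
    by (auto simp: hs_position_def max_def)
  then have d: "hs_diag n = v"
    using hurt_sada_hs_position[of n v] by (simp add: hs_diag_def)
  then show "int (hs_diag n) = 2 * int n + 1 - \<lfloor>real (2 * n + 2) * (golden_ratio - 1)\<rfloor>"
    using v by (simp add: x_def)
  show "hs_diag n < n" if "n > 0"
    using d vn that golden_index_eq_0_iff[of v] by (cases "v = 0") auto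
qed

text \<open>At n = 0 the left side holds, but the fractional part is only
  \<open>2 * golden_ratio - 3\<close>.\<close>

lemma hs_diag_ge_iff:
  assumes "n > 0"
  shows "hs_diag n \<ge> n \<longleftrightarrow> frac (real (2 * n + 2) * (golden_ratio - 1)) > 2 - golden_ratio"
  using hs_diag_lower(2)[of n] hs_diag_upper(2)[of n] assms by fastforce

lemma hs_diag_less_formula:
  assumes "hs_diag n < n"
  shows "int (hs_diag n) = \<lfloor>(4 - 2 * golden_ratio) * real n + (5 - 3 * golden_ratio)\<rfloor>"
proof -
  define x where "x = real (2 * n + 2) * (golden_ratio - 1)"
  have fr: "frac x \<le> 2 - golden_ratio"
    using assms hs_diag_lower(2)[of n] by (fastforce simp: x_def)
  \<comment> \<open>The last bracket lies in [0, 1), so the floor discards it.\<close>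
  have "(4 - 2 * golden_ratio) * real n + (5 - 3 * golden_ratio) =
      of_int (2 * int n + 1 - \<lfloor>x\<rfloor>) + (2 - golden_ratio - frac x)"
    by (simp add: frac_def x_def algebra_simps)
  then have "\<lfloor>(4 - 2 * golden_ratio) * real n + (5 - 3 * golden_ratio)\<rfloor> = 2 * int n + 1 - \<lfloor>x\<rfloor>"
    using fr golden_ratio_bounds frac_ge_0[of x] by (intro floor_unique) linarith+
  then show ?thesis
    using hs_diag_upper(1)[of n] fr by (simp add: x_def)
qed

lemma hs_diag_ge_formula:
  assumes "n > 0" "hs_diag n \<ge> n"
  shows "int (hs_diag n) = \<lfloor>(2 * golden_ratio - 2) * real n\<rfloor> + 1"
proof -
  define x where "x = real (2 * n + 2) * (golden_ratio - 1)"
  have fr: "frac x > 2 - golden_ratio"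
    using assms by (simp add: x_def hs_diag_ge_iff)
  have "(2 * golden_ratio - 2) * real n = of_int (\<lfloor>x\<rfloor> - 1) + (frac x + 3 - 2 * golden_ratio)"
    by (simp add: frac_def x_def algebra_simps)
  then have "\<lfloor>(2 * golden_ratio - 2) * real n\<rfloor> = \<lfloor>x\<rfloor> - 1"
    using fr golden_ratio_bounds frac_lt_1[of x] by (intro floor_unique) linarith+
  then show ?thesis
    using hs_diag_lower(1)[of n] fr by (simp add: x_def)
qed

section \<open>The automaton\<close>

definition fib_conjugate :: "bool list \<Rightarrow> real" where
  "fib_conjugate w = (\<Sum>j<length w. of_bool (w ! j) * (1 - golden_ratio) ^ (length w + 1 - j))"

lemma fib_conjugate_Nil [simp]: "fib_conjugate [] = 0"
  by (simp add: fib_conjugate_def)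

text \<open>Appending a digit raises every exponent by one and gives the new digit exponent 2, so
  reading a digit is an affine map.\<close>

lemma fib_conjugate_snoc:
  "fib_conjugate (w @ [b]) =
     (1 - golden_ratio) * fib_conjugate w + of_bool b * (2 - golden_ratio)"
proof -
  have "(1 - golden_ratio) ^ 2 = 2 - golden_ratio"
    by (simp add: power2_eq_square algebra_simps golden_ratio_sq)
  then show ?thesis
    by (simp add: fib_conjugate_def sum_distrib_left nth_append Suc_diff_le algebra_simps
        numeral_2_eq_2 cong: sum.cong_simp)
qed

lemma fib_Suc_golden_ratio:
  "real (fib (Suc k)) = golden_ratio * real (fib k) + (1 - golden_ratio) ^ k"
proof (induction k rule: fib.induct)
  case (3 k)
  have "(1 - golden_ratio) ^ Suc (Suc k) = (1 - golden_ratio) ^ Suc k + (1 - golden_ratio) ^ k"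
    by (simp add: algebra_simps golden_ratio_sq golden_ratio_mult_left)
  moreover have "golden_ratio * real (fib (Suc (Suc k))) =
      golden_ratio * real (fib (Suc k)) + golden_ratio * real (fib k)"
    by (simp add: distrib_left)
  moreover have "real (fib (Suc (Suc (Suc k)))) = real (fib (Suc (Suc k))) + real (fib (Suc k))"
    by simp
  ultimately show ?case
    using 3 by linarith
qed auto

text \<open>Summing \<open>fib_Suc_golden_ratio\<close> over the digits gives a sum of Fibonacci
  numbers. Thus \<open>fib_conjugate\<close> determines \<phi>n modulo 1.\<close>

lemma fib_conjugate_Ints: "golden_ratio * real (fib_value w) + fib_conjugate w \<in> \<int>"
proof -
  have "golden_ratio * real (fib_value w) + fib_conjugate w =
      (\<Sum>j<length w. of_bool (w ! j) * real (fib (Suc (length w + 1 - j))))"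
    unfolding fib_value_def fib_conjugate_def fib_Suc_golden_ratio of_nat_sum sum_distrib_left
      sum.distrib[symmetric]
    by (rule sum.cong) (simp_all add: algebra_simps)
  also have "\<dots> \<in> \<int>"
    by (intro Ints_sum Ints_mult) auto
  finally show ?thesis .
qed

lemma fib_value_eq_0_iff: "fib_value w = 0 \<longleftrightarrow> True \<notin> set w"
proof -
  have "fib (length w + 1 - j) > 0" if "j < length w" for j
    using that by (simp add: fib_neq_0_nat)
  then have "fib_value w = 0 \<longleftrightarrow> (\<forall>j<length w. \<not> w ! j)"
    unfolding fib_value_def by (subst sum_eq_0_iff) fastforce+
  then show ?thesis
    by (auto simp: in_set_conv_nth)
qed

text \<open>States 5, 6, 7 are reached only by the digit 1, so their transitions under 1 are arbitrary.\<close>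

definition diag_step :: "nat \<Rightarrow> bool \<Rightarrow> nat" where
  "diag_step q b = (if b then [6, 7, 7, 6, 5, 0, 0, 0] else [0, 4, 3, 3, 2, 2, 1, 1]) ! q"

text \<open>
  The inner end points are the iterated preimages, under the two digit maps of \<open>fib_conjugate\<close>, of the values
  where the fractional part in \<open>hs_diag_ge_iff\<close> crosses 0 or \<open>2 - \<phi>\<close>, together with
  \<open>2\<phi> - 3\<close>, which separates the strings ending in 0 from those ending in 1.
\<close>

definition diag_zone :: "nat \<Rightarrow> real set" where
  "diag_zone q =
    [{0},
     {golden_ratio - 2<..<golden_ratio / 2 - 1},
     {golden_ratio / 2 - 1<..<3 * golden_ratio / 2 - 5 / 2},
     {3 * golden_ratio / 2 - 5 / 2<..<golden_ratio - 3 / 2},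
     {golden_ratio - 3 / 2<..<2 * golden_ratio - 3},
     {2 * golden_ratio - 3<..<golden_ratio / 2 - 1 / 2},
     {golden_ratio / 2 - 1 / 2<..<3 * golden_ratio / 2 - 2},
     {3 * golden_ratio / 2 - 2<..<golden_ratio - 1}] ! q"

text \<open>The digit maps are affine, so it suffices to compare the images of the end points with
  the target zone.\<close>

lemma diag_zone_step:
  assumes "q < 8" "e \<in> diag_zone q" "b \<Longrightarrow> q < 5"
  shows "(1 - golden_ratio) * e + of_bool b * (2 - golden_ratio) \<in> diag_zone (diag_step q b)"
proof (cases "q = 0")
  case True
  then show ?thesis
    using assms(2) golden_ratio_bounds by (auto simp: diag_zone_def diag_step_def)
next
  case False
  \<comment> \<open>Stated with the positive factor, as the slope \<open>1 - golden_ratio\<close>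
    reverses the order.\<close>
  have mono: "(golden_ratio - 1) * l < (golden_ratio - 1) * x \<and>
      (golden_ratio - 1) * x < (golden_ratio - 1) * u" if "x \<in> {l<..<u}" for l x u
    using that golden_ratio_bounds by (auto intro!: mult_strict_left_mono)
  consider "q = 1" | "q = 2" | "q = 3" | "q = 4" | "q = 5" | "q = 6" | "q = 7"
    using False assms(1) by linarith
  then show ?thesis
    using assms(2,3) golden_ratio_bounds
    by cases (auto simp: diag_zone_def diag_step_def algebra_simps golden_ratio_sq golden_ratio_mult_left
        add_divide_distrib diff_divide_distrib
        simp del: greaterThanLessThan_iff dest!: mono intro!: greaterThanLessThan_iff[THEN iffD2])
qed

text \<open>State 0 accepts because d(0) = 0; the other accepting states are those of
  \<open>diag_zone_accepting\<close>.\<close>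

definition diag_automaton :: "(nat, bool) automaton" where
  "diag_automaton =
     \<lparr>states = {..<8}, trans_fun = diag_step, start = 0, accepting = {0, 1, 2, 4, 5, 6}\<rparr>"

lemma less_8_iff: "q < 8 \<longleftrightarrow> q \<in> {0, 1, 2, 3, 4, 5, 6, 7}" for q :: nat
  by auto

lemma diag_step_less: "q < 8 \<Longrightarrow> diag_step q b < 8"
  by (cases b) (auto simp: less_8_iff diag_step_def)

lemma finite_automaton_diag: "finite_automaton diag_automaton"
  by (auto simp: finite_automaton_def diag_automaton_def diag_step_less)

text \<open>The last conjunct turns the absence of adjacent ones into the premise
  \<open>q < 5\<close> of \<open>diag_zone_step\<close>.\<close>

lemma diag_automaton_run:
  assumes "\<And>j. j + 1 < length w \<Longrightarrow> \<not> (w ! j \<and> w ! (j + 1))"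
  defines "q \<equiv> foldl diag_step 0 w"
  shows "q < 8 \<and> fib_conjugate w \<in> diag_zone q \<and> (q = 0 \<longleftrightarrow> True \<notin> set w) \<and>
         (q \<ge> 5 \<longrightarrow> w \<noteq> [] \<and> last w)"
  using assms(1) unfolding q_def
proof (induction w rule: rev_induct)
  case Nil
  then show ?case
    by (simp add: diag_zone_def)
next
  case (snoc b w)
  define q where "q = foldl diag_step 0 w"
  have "\<not> (w ! j \<and> w ! (j + 1))" if "j + 1 < length w" for j
    using snoc.prems[of j] that by (simp add: nth_append)
  then have IH: "q < 8" "fib_conjugate w \<in> diag_zone q" "q = 0 \<longleftrightarrow> True \<notin> set w"
      "q \<ge> 5 \<Longrightarrow> w \<noteq> [] \<and> last w"
    using snoc.IH by (auto simp: q_def)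
  have b: "q < 5" if b
  proof (rule ccontr)
    assume "\<not> q < 5"
    then have "w \<noteq> []" "last w"
      using IH by auto
    then show False
      using snoc.prems[of "length w - 1"] that by (auto simp: nth_append last_conv_nth)
  qed
  have "diag_step q b = 0 \<longleftrightarrow> q = 0 \<and> \<not> b" "diag_step q b \<ge> 5 \<longrightarrow> b"
    using IH(1) b by (cases b; auto simp: less_8_iff diag_step_def)+
  then show ?case
    using IH diag_step_less[of q b] diag_zone_step[of q "fib_conjugate w" b] b
    by (auto simp: fib_conjugate_snoc simp flip: q_def)
qed

lemma diag_zone_accepting:
  assumes "q < 8" "q \<noteq> 0" "e \<in> diag_zone q"
  shows "frac (2 * golden_ratio - 2 * e) > 2 - golden_ratio \<longleftrightarrow> q \<in> {1, 2, 4, 5, 6}"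
proof -
  have fr: "frac y = y - of_int m" if "of_int m \<le> y" "y < of_int m + 1" for y :: real and m
    using floor_unique[of m y] that by (simp add: frac_def)
  \<comment> \<open>On all these zones the argument of \<open>frac\<close> lies between 2 and 4, so
    its floor is 2 or 3.\<close>
  show ?thesis
    using assms golden_ratio_bounds
      fr[of 3 "2 * golden_ratio - 2 * e"] fr[of 2 "2 * golden_ratio - 2 * e"]
    by (auto simp: less_8_iff diag_zone_def)
qed

lemma diag_automaton_correct:
  assumes "zeckendorf_rep w n"
  shows "accepts diag_automaton w \<longleftrightarrow> hs_diag n \<ge> n"
proof -
  define q where "q = foldl diag_step 0 w"
  have n: "n = fib_value w"
    using assms by (simp add: zeckendorf_rep_def)
  have q: "q < 8" "fib_conjugate w \<in> diag_zone q" "q = 0 \<longleftrightarrow> n = 0"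
    using assms diag_automaton_run[of w]
    by (auto simp: zeckendorf_rep_def q_def n fib_value_eq_0_iff)
  have acc: "accepts diag_automaton w \<longleftrightarrow> q \<in> {0, 1, 2, 4, 5, 6}"
    by (simp add: accepts_def diag_automaton_def q_def)
  show ?thesis
  proof (cases "n = 0")
    case True
    then show ?thesis
      using acc q by simp
  next
    case False
    obtain k where "golden_ratio * real n + fib_conjugate w = of_int k"
      using fib_conjugate_Ints[of w] unfolding n by (elim Ints_cases)
    then have e: "fib_conjugate w = of_int k - golden_ratio * real n"
      by simp
    have "real (2 * n + 2) * (golden_ratio - 1) =
        2 * golden_ratio - 2 * fib_conjugate w + of_int (2 * k - 2 * int n - 2)"
      unfolding e by (simp add: algebra_simps)
    then have "frac (real (2 * n + 2) * (golden_ratio - 1)) =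
        frac (2 * golden_ratio - 2 * fib_conjugate w)"
      by (simp only: frac_add_of_int_right)
    then show ?thesis
      using hs_diag_ge_iff[of n] diag_zone_accepting[of q "fib_conjugate w"] q acc False by simp
  qed
qed

theorem theorem8:
  shows "(\<exists>M :: (nat, bool) automaton.
            finite_automaton M \<and> card (states M) = 8 \<and>
            (\<forall>n w. zeckendorf_rep w n \<longrightarrow> (accepts M w \<longleftrightarrow> hs_diag n \<ge> n))) \<and>
         (\<forall>n. hs_diag n < n \<longrightarrow>
            int (hs_diag n) =
              \<lfloor>(4 - 2 * golden_ratio) * real n + (5 - 3 * golden_ratio)\<rfloor>) \<and>
         (\<forall>n\<ge>1. hs_diag n \<ge> n \<longrightarrow>
            int (hs_diag n) = \<lfloor>(2 * golden_ratio - 2) * real n\<rfloor> + 1)"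
proof (intro conjI exI[of _ diag_automaton])
  show "card (states diag_automaton) = 8"
    by (simp add: diag_automaton_def)
qed (auto simp: finite_automaton_diag diag_automaton_correct hs_diag_less_formula hs_diag_ge_formula)

end
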